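(* The two-stage robust selection problem \textsc{R2ST} under the discrete budgeted uncertainty set $\mathcal{U}^d$, i.e. $\min_{\mathbf{x}\in\Phi_1}\big(\mathbf{C}\mathbf{x}+\max_{\mathbf{c}\in\mathcal{U}^d}\min_{\mathbf{y}\in\Phi_{\mathbf{x}}}\mathbf{c}\mathbf{y}\big)$, can be formulated (same optimal value, and the $\mathbf{x}$-part of an optimal solution is an optimal solution to \textsc{R2ST}) as the following mixed integer linear program, where $\{\alpha^1,\dots,\alpha^S\}=\{0\}\cup\{\underline{c}_i:i\in[n]\}\cup\{\overline{c}_i:i\in[n]\}$: $$\begin{array}{lll} \min & \lambda\\ \text{s.t.} & \lambda\ge\sum_{i\in[n]}C_ix_i+\Big(p-\sum_{i\in[n]}x_i\Big)\alpha^\ell-\sum_{i\in[n]}(1-x_i)[\alpha^\ell-\underline{c}_i]_++\Gamma\pi^\ell+\sum_{i\in[n]}\rho^\ell_i & \ell\in[S]\\ & \sum_{i\in[n]}x_i\le p\\ & \pi^\ell+\rho^\ell_i\ge(1-x_i)\big([\alpha^\ell-\underline{c}_i]_+-[\alpha^\ell-\underline{c}_i-d_i]_+\big) & i\in[n],\ \ell\in[S]\\ & x_i\in\{0,1\} & i\in[n]\\ & \pi^\ell\ge 0,\ \rho^\ell_i\ge 0 & i\in[n],\ \ell\in[S]. \end{array}$$ This formulation has $O(n^2)$ variables and $O(n^2)$ constraints.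
   Context: Let $[n]=\{1,\dots,n\}$, $p\in[n]$, $\mathbf{C}=(C_1,\dots,C_n)$ a vector of first-stage costs, $0\le\underline{c}_i\le\overline{c}_i$ and $d_i=\overline{c}_i-\underline{c}_i$ for $i\in[n]$, and $\Gamma$ a nonnegative integer. $[a]_+=\max\{0,a\}$ and $\mathbf{c}\mathbf{y}=\sum_{i\in[n]}c_iy_i$. $\Phi_1=\{\mathbf{x}\in\{0,1\}^n:\sum_{i\in[n]}x_i\le p\}$. For $\mathbf{x}\in\Phi_1$, $\Phi_{\mathbf{x}}=\{\mathbf{y}\in\{0,1\}^n:\sum_{i\in[n]}(x_i+y_i)=p,\ x_i+y_i\le 1\ \text{for all } i\in[n]\}$. $\mathcal{U}^d=\{(\underline{c}_i+\delta_i)_{i\in[n]}:\delta_i\in\{0,d_i\},\ |\{i\in[n]:\delta_i=d_i\}|\le\Gamma\}$.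
   Formalization: In the uncertainty set, the budget Γ bounds the number of items with δ_i ≠ 0 rather than δ_i = d_i; these agree when all d_i > 0, but the literal count charges items with d_i = 0 and makes the claim false (e.g. n=p=2, lower costs 0, d=(0,5), Γ=1, C=(100,100)). *)

theory Defs
  imports Complex_Main "HOL-Library.FuncSet" "HOL-Library.Landau_Symbols"
begin

section \<open>Mixed integer linear programs\<close>

text \<open>
  A minimisation problem over assignments \<open>z :: 'v \<Rightarrow> real\<close> with finitely many variables of type
  \<open>'v\<close> and inequalities \<open>lhs k z \<ge> rhs k z\<close> labelled by \<open>'k\<close>. The two sides are kept as functions of
  the assignment, so that constraints can be written in unnormalised form; their linearity is part
  of the predicate \<open>is_milp\<close>.
\<close>

record ('v, 'k) milp =
  vars :: "'v set"
  binaries :: "'v set"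
  nonnegs :: "'v set"
  objective :: "('v \<Rightarrow> real) \<Rightarrow> real"
  ineqs :: "'k set"
  lhs :: "'k \<Rightarrow> ('v \<Rightarrow> real) \<Rightarrow> real"
  rhs :: "'k \<Rightarrow> ('v \<Rightarrow> real) \<Rightarrow> real"

definition affine_in :: "'v set \<Rightarrow> (('v \<Rightarrow> real) \<Rightarrow> real) \<Rightarrow> bool" where
  "affine_in V f \<longleftrightarrow> (\<exists>a b. \<forall>z. f z = (\<Sum>v\<in>V. a v * z v) + b)"

definition is_milp :: "('v, 'k) milp \<Rightarrow> bool" where
  "is_milp P \<longleftrightarrow> finite (vars P) \<and> finite (ineqs P) \<and>
     binaries P \<subseteq> vars P \<and> nonnegs P \<subseteq> vars P \<and>
     affine_in (vars P) (objective P) \<and>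
     (\<forall>k\<in>ineqs P. affine_in (vars P) (lhs P k) \<and> affine_in (vars P) (rhs P k))"

definition feasible :: "('v, 'k) milp \<Rightarrow> ('v \<Rightarrow> real) \<Rightarrow> bool" where
  "feasible P z \<longleftrightarrow> (\<forall>k\<in>ineqs P. lhs P k z \<ge> rhs P k z) \<and>
     (\<forall>v\<in>binaries P. z v \<in> {0, 1}) \<and> (\<forall>v\<in>nonnegs P. z v \<ge> 0)"

definition optimal :: "('v, 'k) milp \<Rightarrow> ('v \<Rightarrow> real) \<Rightarrow> bool" where
  "optimal P z \<longleftrightarrow> feasible P z \<and> (\<forall>z'. feasible P z' \<longrightarrow> objective P z \<le> objective P z')"

definition has_optimal_value :: "('v, 'k) milp \<Rightarrow> real \<Rightarrow> bool" where
  "has_optimal_value P v \<longleftrightarrow> (\<exists>z. optimal P z \<and> objective P z = v)"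

definition num_vars :: "('v, 'k) milp \<Rightarrow> nat" where
  "num_vars P = card (vars P)"

text \<open>Binary restrictions and sign restrictions are counted as constraints too.\<close>

definition num_constraints :: "('v, 'k) milp \<Rightarrow> nat" where
  "num_constraints P = card (ineqs P) + card (binaries P) + card (nonnegs P)"

section \<open>The two-stage robust selection problem\<close>

text \<open>Only the components with index in \<open>{1..num_items I}\<close> of the vectors of an instance matter.\<close>

record r2st =
  num_items :: nat
  sel :: nat
  first_cost :: "nat \<Rightarrow> real"
  lower_cost :: "nat \<Rightarrow> real"
  upper_cost :: "nat \<Rightarrow> real"
  Gam :: nat

abbreviation items :: "r2st \<Rightarrow> nat set" where
  "items I \<equiv> {1..num_items I}"

definition valid_instance :: "r2st \<Rightarrow> bool" where
  "valid_instance I \<longleftrightarrow> sel I \<in> items I \<and>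
     (\<forall>i\<in>items I. 0 \<le> lower_cost I i \<and> lower_cost I i \<le> upper_cost I i)"

definition dev :: "r2st \<Rightarrow> nat \<Rightarrow> real" where
  "dev I i = upper_cost I i - lower_cost I i"

definition first_stage :: "r2st \<Rightarrow> (nat \<Rightarrow> real) set" where
  "first_stage I = {x \<in> items I \<rightarrow>\<^sub>E {0, 1}. (\<Sum>i\<in>items I. x i) \<le> real (sel I)}"

definition second_stage :: "r2st \<Rightarrow> (nat \<Rightarrow> real) \<Rightarrow> (nat \<Rightarrow> real) set" where
  "second_stage I x = {y \<in> items I \<rightarrow>\<^sub>E {0, 1}.
     (\<Sum>i\<in>items I. x i + y i) = real (sel I) \<and> (\<forall>i\<in>items I. x i + y i \<le> 1)}"

text \<open>
  At most \<open>Gam I\<close> components deviate from their lower value. The deviating components are counted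
  by \<open>\<delta> i \<noteq> 0\<close> and not by \<open>\<delta> i = dev I i\<close>: the two agree when \<open>dev I i > 0\<close>, but the latter would
  also charge the budget for every item with \<open>dev I i = 0\<close>.
\<close>

definition uncertainty_set :: "r2st \<Rightarrow> (nat \<Rightarrow> real) set" where
  "uncertainty_set I = {(\<lambda>i\<in>items I. lower_cost I i + \<delta> i) | \<delta>.
     (\<forall>i\<in>items I. \<delta> i \<in> {0, dev I i}) \<and> card {i \<in> items I. \<delta> i \<noteq> 0} \<le> Gam I}"

text \<open>
  For a valid instance and \<open>x \<in> first_stage I\<close>, every minimum and maximum below is taken over a
  finite nonempty set.
\<close>

definition r2st_cost :: "r2st \<Rightarrow> (nat \<Rightarrow> real) \<Rightarrow> real" where
  "r2st_cost I x = (\<Sum>i\<in>items I. first_cost I i * x i) +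
     (MAX c\<in>uncertainty_set I. MIN y\<in>second_stage I x. \<Sum>i\<in>items I. c i * y i)"

definition r2st_value :: "r2st \<Rightarrow> real" where
  "r2st_value I = (MIN x\<in>first_stage I. r2st_cost I x)"

definition r2st_optimal :: "r2st \<Rightarrow> (nat \<Rightarrow> real) \<Rightarrow> bool" where
  "r2st_optimal I x \<longleftrightarrow> x \<in> first_stage I \<and> r2st_cost I x = r2st_value I"

section \<open>The formulation\<close>

definition pos_part :: "real \<Rightarrow> real" where
  "pos_part a = max 0 a"

definition breakpoints :: "r2st \<Rightarrow> real set" where
  "breakpoints I = {0} \<union> lower_cost I ` items I \<union> upper_cost I ` items I"

abbreviation num_breakpoints :: "r2st \<Rightarrow> nat" where
  "num_breakpoints I \<equiv> card (breakpoints I)"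

abbreviation levels :: "r2st \<Rightarrow> nat set" where
  "levels I \<equiv> {1..num_breakpoints I}"

datatype var = Lam | X nat | Pi_var nat | Rho nat nat

datatype ineq = Lam_bound nat | Cardinality | Dual nat nat

text \<open>In \<open>Rho i l\<close> and \<open>Dual i l\<close>, \<open>i\<close> is the item and \<open>l\<close> indexes the breakpoint \<open>\<alpha> l\<close>.\<close>

fun r2st_lhs :: "r2st \<Rightarrow> (nat \<Rightarrow> real) \<Rightarrow> ineq \<Rightarrow> (var \<Rightarrow> real) \<Rightarrow> real" where
  "r2st_lhs I \<alpha> (Lam_bound l) z = z Lam"
| "r2st_lhs I \<alpha> Cardinality z = real (sel I)"
| "r2st_lhs I \<alpha> (Dual i l) z = z (Pi_var l) + z (Rho i l)"

fun r2st_rhs :: "r2st \<Rightarrow> (nat \<Rightarrow> real) \<Rightarrow> ineq \<Rightarrow> (var \<Rightarrow> real) \<Rightarrow> real" where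
  "r2st_rhs I \<alpha> (Lam_bound l) z =
     (\<Sum>i\<in>items I. first_cost I i * z (X i))
     + (real (sel I) - (\<Sum>i\<in>items I. z (X i))) * \<alpha> l
     - (\<Sum>i\<in>items I. (1 - z (X i)) * pos_part (\<alpha> l - lower_cost I i))
     + real (Gam I) * z (Pi_var l)
     + (\<Sum>i\<in>items I. z (Rho i l))"
| "r2st_rhs I \<alpha> Cardinality z = (\<Sum>i\<in>items I. z (X i))"
| "r2st_rhs I \<alpha> (Dual i l) z =
     (1 - z (X i)) *
     (pos_part (\<alpha> l - lower_cost I i) - pos_part (\<alpha> l - lower_cost I i - dev I i))"

definition pi_rho_vars :: "r2st \<Rightarrow> var set" where
  "pi_rho_vars I = Pi_var ` levels I \<union> {Rho i l | i l. i \<in> items I \<and> l \<in> levels I}"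

definition r2st_milp :: "r2st \<Rightarrow> (nat \<Rightarrow> real) \<Rightarrow> (var, ineq) milp" where
  "r2st_milp I \<alpha> = \<lparr>
     vars = {Lam} \<union> X ` items I \<union> pi_rho_vars I,
     binaries = X ` items I,
     nonnegs = pi_rho_vars I,
     objective = (\<lambda>z. z Lam),
     ineqs = Lam_bound ` levels I \<union> {Cardinality} \<union>
       {Dual i l | i l. i \<in> items I \<and> l \<in> levels I},
     lhs = r2st_lhs I \<alpha>,
     rhs = r2st_rhs I \<alpha>\<rparr>"

definition x_part :: "r2st \<Rightarrow> (var \<Rightarrow> real) \<Rightarrow> nat \<Rightarrow> real" where
  "x_part I z = (\<lambda>i\<in>items I. z (X i))"

text \<open>
  The filter \<open>n \<rightarrow> \<infinity>\<close> on valid instances: a Landau statement along it has a constant depending on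
  nothing but the size \<open>n\<close> being large, uniformly in all other data of the instance.
\<close>

definition large_instances :: "r2st filter" where
  "large_instances = inf (filtercomap num_items at_top) (principal {I. valid_instance I})"

end

theory Submission imports Defs
begin

text \<open>
  Two linear programming dualities turn the inner problem into the constraints. For fixed costs
  \<open>c\<close>, selecting the \<open>q\<close> cheapest available items costs the maximum over \<open>t\<close> of
  \<open>q t - \<Sum>i. [t - c i]\<^sub>+\<close>, attained at a threshold cost, hence at a breakpoint.
  For fixed \<open>t\<close>, the adversary raises the \<open>\<Gamma>\<close> items of largest gain, and this total gain is the
  minimum of \<open>\<Gamma> \<pi> + \<Sum>i. \<rho> i\<close> subject to \<open>\<pi> + \<rho> i \<ge> gain i\<close>. Both strong dualities
  are read off a set of smallest elements; the two maximisations commute.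
\<close>

section \<open>Dualities for selecting extreme elements\<close>

text \<open>Greedy growth: add a least element of \<open>A - Y\<close>. It lies below the rest by
  minimality, and the older members stay below a rest that only shrank.\<close>

lemma exists_smallest_subset:
  fixes f :: "'a \<Rightarrow> 'b::linorder"
  assumes "finite A" "q \<le> card A"
  shows "\<exists>Y\<subseteq>A. card Y = q \<and> (\<forall>i\<in>Y. \<forall>j\<in>A - Y. f i \<le> f j)"
  using assms(2)
proof (induction q)
  case 0
  show ?case by (intro exI[of _ "{}"]) simp
next
  case (Suc q)
  then obtain Y where Y: "Y \<subseteq> A" "card Y = q" "\<forall>i\<in>Y. \<forall>j\<in>A - Y. f i \<le> f j"
    by auto
  have finY: "finite Y" using Y(1) assms(1) by (rule finite_subset)
  have ne: "A - Y \<noteq> {}" using Y(1,2) Suc.prems by auto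
  obtain m where m: "m \<in> A - Y" "\<forall>j\<in>A - Y. f m \<le> f j"
    using assms(1) ne by (metis arg_min_if_finite(1) arg_min_least finite_Diff)
  show ?case
  proof (intro exI[of _ "insert m Y"] conjI)
    show "insert m Y \<subseteq> A" using m(1) Y(1) by auto
    show "card (insert m Y) = Suc q" using m(1) Y(2) finY by auto
    show "\<forall>i\<in>insert m Y. \<forall>j\<in>A - insert m Y. f i \<le> f j" using m Y(3) by auto
  qed
qed

text \<open>Summing \<open>w i \<le> \<pi> + \<rho> i\<close> over \<open>S\<close> gives
  \<open>card S\<close> copies of \<open>\<pi>\<close>; nonnegativity of \<open>\<pi>\<close> and
  \<open>\<rho>\<close> then allows enlarging \<open>card S\<close> to \<open>G\<close> and
  \<open>S\<close> to \<open>A\<close>.\<close>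

lemma budget_weak_duality:
  fixes w :: "'a \<Rightarrow> real"
  assumes "finite A" "S \<subseteq> A" "card S \<le> G" "0 \<le> \<pi>"
    and "\<And>i. i \<in> A \<Longrightarrow> 0 \<le> \<rho> i" "\<And>i. i \<in> A \<Longrightarrow> w i \<le> \<pi> + \<rho> i"
  shows "sum w S \<le> real G * \<pi> + sum \<rho> A"
proof -
  have "sum w S \<le> (\<Sum>i\<in>S. \<pi> + \<rho> i)" using assms by (intro sum_mono) auto
  also have "\<dots> = real (card S) * \<pi> + sum \<rho> S" by (simp add: sum.distrib)
  also have "\<dots> \<le> real G * \<pi> + sum \<rho> A"
    using assms by (intro add_mono mult_right_mono sum_mono2) auto
  finally show ?thesis .
qed

text \<open>\<open>S\<close> collects the \<open>G\<close> largest weights, the price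
  \<open>\<pi>\<close> is the largest weight left out, and \<open>\<rho>\<close> is the excess over
  that price.\<close>

lemma budget_strong_duality:
  fixes w :: "'a \<Rightarrow> real"
  assumes "finite A" "\<And>i. i \<in> A \<Longrightarrow> 0 \<le> w i"
  shows "\<exists>S \<pi> \<rho>. S \<subseteq> A \<and> card S \<le> G \<and> 0 \<le> \<pi> \<and>
    (\<forall>i\<in>A. 0 \<le> \<rho> i \<and> w i \<le> \<pi> + \<rho> i) \<and> real G * \<pi> + sum \<rho> A = sum w S"
proof (cases "card A \<le> G")
  case True
  \<comment> \<open>The budget covers all of \<open>A\<close>, so its price is 0 and
    \<open>\<rho>\<close> carries the full weights.\<close>
  then show ?thesis
    using assms(2) by (intro exI[of _ A] exI[of _ 0] exI[of _ w]) auto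
next
  case False
  then obtain S where S: "S \<subseteq> A" "card S = G" "\<forall>i\<in>S. \<forall>j\<in>A - S. - w i \<le> - w j"
    using exists_smallest_subset[of A G "\<lambda>i. - w i"] assms(1) by auto
  \<comment> \<open>A left-out weight exists because \<open>G < card A\<close>; this choice also
    works for \<open>G = 0\<close>, where no selected weight exists.\<close>
  define \<pi> where "\<pi> = Max (w ` (A - S))"
  define \<rho> where "\<rho> i = (if i \<in> S then w i - \<pi> else 0)" for i
  have fin: "finite (w ` (A - S))" using assms(1) by auto
  have ne: "A - S \<noteq> {}" using False S(1,2) by auto
  then have mem: "\<pi> \<in> w ` (A - S)" unfolding \<pi>_def using fin by (intro Max_in) auto
  have out: "w i \<le> \<pi>" if "i \<in> A - S" for i
    unfolding \<pi>_def using that fin by (intro Max_ge) auto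
  have "sum \<rho> A = (\<Sum>i\<in>S. w i - \<pi>)"
    using S(1) assms(1) by (intro sum.mono_neutral_cong_right) (auto simp: \<rho>_def)
  \<comment> \<open>The budget is exhausted, \<open>card S = G\<close>, so the \<open>G\<close>
    subtracted copies of \<open>\<pi>\<close> cancel \<open>real G * \<pi>\<close>.\<close>
  then have eq: "real G * \<pi> + sum \<rho> A = sum w S"
    using S(2) by (simp add: sum_subtractf)
  have "0 \<le> \<rho> i \<and> w i \<le> \<pi> + \<rho> i" if "i \<in> A" for i
    using mem S(3) out[of i] that by (auto simp: \<rho>_def)
  moreover have "0 \<le> \<pi>" using mem assms(2) by auto
  ultimately show ?thesis using S(1,2) eq by blast
qed

section \<open>The second stage\<close>

text \<open>Lagrangian dual function of the second stage: \<open>t\<close> is the multiplier of the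
  cardinality equation, and minimising \<open>(c i - t) * y i\<close> over
  \<open>0 \<le> y i \<le> 1 - x i\<close> leaves the subtracted terms.\<close>

definition selection_dual :: "r2st \<Rightarrow> (nat \<Rightarrow> real) \<Rightarrow> (nat \<Rightarrow> real) \<Rightarrow> real \<Rightarrow> real" where
  "selection_dual I x c t =
     (real (sel I) - (\<Sum>i\<in>items I. x i)) * t - (\<Sum>i\<in>items I. (1 - x i) * pos_part (t - c i))"

text \<open>Once the cardinality equation distributes \<open>t\<close> over the items, the claim is
  termwise: \<open>y i * (t - c i)\<close> is at most
  \<open>(1 - x i) * pos_part (t - c i)\<close>.\<close>

lemma second_stage_weak_duality:
  assumes x: "\<And>i. i \<in> items I \<Longrightarrow> x i \<in> {0, 1}" and y: "y \<in> second_stage I x"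
  shows "selection_dual I x c t \<le> (\<Sum>i\<in>items I. c i * y i)"
proof -
  have "real (sel I) - (\<Sum>i\<in>items I. x i) = (\<Sum>i\<in>items I. y i)"
    using y by (simp add: second_stage_def sum.distrib)
  then have "selection_dual I x c t
      = (\<Sum>i\<in>items I. y i * t - (1 - x i) * pos_part (t - c i))"
    by (simp add: selection_dual_def sum_distrib_right sum_subtractf)
  also have "\<dots> \<le> (\<Sum>i\<in>items I. c i * y i)"
  proof (rule sum_mono)
    fix i assume i: "i \<in> items I"
    have "x i \<in> {0, 1}" "y i \<in> {0, 1}" "x i + y i \<le> 1"
      using x[OF i] y i by (auto simp: second_stage_def PiE_def Pi_def)
    then show "y i * t - (1 - x i) * pos_part (t - c i) \<le> c i * y i"
      by (auto simp: pos_part_def)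
  qed
  finally show ?thesis .
qed

text \<open>Take the cheapest free items for \<open>y\<close> and the largest selected cost for
  \<open>t\<close>. That \<open>t\<close> is 0 or a cost is what makes finitely many levels
  suffice.\<close>

lemma second_stage_strong_duality:
  assumes I: "valid_instance I" and x: "x \<in> first_stage I"
    and c: "\<And>i. i \<in> items I \<Longrightarrow> 0 \<le> c i"
  shows "\<exists>y\<in>second_stage I x. \<exists>t\<in>insert 0 (c ` items I).
    (\<Sum>i\<in>items I. c i * y i) = selection_dual I x c t"
proof -
  let ?N = "items I"
  define A where "A = {i \<in> ?N. x i = 0}"
  have x01: "x i \<in> {0, 1}" if "i \<in> ?N" for i
    using x that by (auto simp: first_stage_def PiE_def Pi_def)
  have A: "finite A" "A \<subseteq> ?N" by (auto simp: A_def)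
  have "(\<Sum>i\<in>?N. x i) = (\<Sum>i\<in>?N - A. 1)"
    using x01 by (intro sum.mono_neutral_cong_right) (auto simp: A_def)
  then have sumx: "(\<Sum>i\<in>?N. x i) = real (card (?N - A))" by simp
  have le: "card (?N - A) \<le> sel I"
    using x sumx by (simp add: first_stage_def)
  have cardN: "card (?N - A) + card A = num_items I"
    using A card_mono[of ?N A] by (simp add: card_Diff_subset)
  define q where "q = sel I - card (?N - A)"
  have q: "real q = real (sel I) - (\<Sum>i\<in>?N. x i)" using le sumx by (simp add: q_def)
  \<comment> \<open>Enough free items remain because \<open>sel I \<le> num_items I\<close>.\<close>
  have "q \<le> card A" using I cardN by (auto simp: q_def valid_instance_def)
  then obtain Y where Y: "Y \<subseteq> A" "card Y = q" "\<forall>i\<in>Y. \<forall>j\<in>A - Y. c i \<le> c j"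
    using exists_smallest_subset[OF A(1)] by blast
  have finY: "finite Y" using Y(1) A(1) by (rule finite_subset)
  \<comment> \<open>With nothing to select, \<open>t\<close> only has to lie below all free costs; 0
    does since costs are nonnegative. This is why 0 is a breakpoint.\<close>
  define t where "t = (if Y = {} then 0 else Max (c ` Y))"
  have t_mem: "t \<in> insert 0 (c ` ?N)"
  proof (cases "Y = {}")
    case False
    then have "t \<in> c ` Y" using Max_in[of "c ` Y"] finY by (simp add: t_def)
    then show ?thesis using Y(1) A(2) by blast
  qed (simp add: t_def)
  have inY: "c i \<le> t" if "i \<in> Y" for i
    using that finY by (auto simp: t_def)
  have outY: "t \<le> c j" if "j \<in> A - Y" for j
  proof (cases "Y = {}")
    case True
    then show ?thesis using that c A(2) by (auto simp: t_def)
  next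
    case False
    then have "t \<in> c ` Y" using Max_in[of "c ` Y"] finY by (auto simp: t_def)
    then show ?thesis using Y(3) that by auto
  qed
  define y where "y = (\<lambda>i\<in>?N. of_bool (i \<in> Y) :: real)"
  have YN: "?N \<inter> Y = Y" using Y(1) A(2) by auto
  have sumy: "(\<Sum>i\<in>?N. y i) = real q"
    using YN Y(2) by (simp add: y_def sum.inter_restrict[symmetric])
  have y: "y \<in> second_stage I x"
  proof -
    have "x i + y i \<le> 1" if "i \<in> ?N" for i
      using that x01[OF that] Y(1) by (auto simp: y_def A_def)
    then show ?thesis
      using q sumy by (auto simp: second_stage_def sum.distrib) (auto simp: y_def)
  qed
  \<comment> \<open>Complementary slackness, item by item: a selected item gives
    \<open>t - (t - c i)\<close>, a free unselected one has \<open>t \<le> c i\<close>, and one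
    bought in the first stage has \<open>1 - x i = 0 = y i\<close>.\<close>
  have "(\<Sum>i\<in>?N. c i * y i) = (\<Sum>i\<in>?N. y i * t - (1 - x i) * pos_part (t - c i))"
  proof (rule sum.cong)
    fix i assume i: "i \<in> ?N"
    consider "i \<in> Y" | "i \<in> A - Y" | "i \<notin> A" by auto
    then show "c i * y i = y i * t - (1 - x i) * pos_part (t - c i)"
    proof cases
      case 1
      then show ?thesis using i inY[of i] Y(1) by (auto simp: y_def pos_part_def A_def)
    next
      case 2
      then show ?thesis using i outY[of i] by (auto simp: y_def pos_part_def)
    next
      case 3
      then show ?thesis using i x01[of i] Y(1) by (auto simp: y_def A_def)
    qed
  qed simp
  also have "\<dots> = selection_dual I x c t"
    using q sumy by (simp add: selection_dual_def sum_subtractf sum_distrib_right[symmetric])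
  finally show ?thesis using y t_mem by blast
qed

section \<open>Finiteness and nonemptiness of the feasible sets, and the min-max cost as
  quantifiers\<close>

lemma finite_first_stage: "finite (first_stage I)"
  by (rule finite_subset[of _ "items I \<rightarrow>\<^sub>E {0, 1}"]) (auto simp: first_stage_def intro: finite_PiE)

lemma finite_second_stage: "finite (second_stage I x)"
  by (rule finite_subset[of _ "items I \<rightarrow>\<^sub>E {0, 1}"]) (auto simp: second_stage_def intro: finite_PiE)

lemma finite_uncertainty_set: "finite (uncertainty_set I)"
proof (rule finite_subset)
  show "uncertainty_set I \<subseteq> (\<Pi>\<^sub>E i\<in>items I. {lower_cost I i, lower_cost I i + dev I i})"
    by (fastforce simp: uncertainty_set_def)
qed (auto intro: finite_PiE)

lemma zero_in_first_stage: "(\<lambda>i\<in>items I. 0) \<in> first_stage I"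
  by (auto simp: first_stage_def)

lemma lower_cost_in_uncertainty_set: "(\<lambda>i\<in>items I. lower_cost I i) \<in> uncertainty_set I"
  unfolding uncertainty_set_def
  by (rule CollectI, rule exI[of _ "\<lambda>_. 0"]) auto

text \<open>Trades the nested \<open>MAX\<close> and \<open>MIN\<close> for quantifiers over
  scenarios and responses, the form in which the dualities apply.\<close>

lemma r2st_cost_le_iff:
  assumes "valid_instance I" "x \<in> first_stage I"
  shows "r2st_cost I x \<le> v \<longleftrightarrow> (\<forall>c\<in>uncertainty_set I. \<exists>y\<in>second_stage I x.
    (\<Sum>i\<in>items I. first_cost I i * x i) + (\<Sum>i\<in>items I. c i * y i) \<le> v)"
proof -
  \<comment> \<open>Strong duality at zero costs serves only to produce some feasible
    response.\<close>
  have "second_stage I x \<noteq> {}"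
    using second_stage_strong_duality[OF assms, of "\<lambda>_. 0"] by auto
  then have "(MIN y\<in>second_stage I x. \<Sum>i\<in>items I. c i * y i) \<le> u \<longleftrightarrow>
      (\<exists>y\<in>second_stage I x. (\<Sum>i\<in>items I. c i * y i) \<le> u)" for c u
    using finite_second_stage[of I x] by (subst Min_le_iff) auto
  moreover have "uncertainty_set I \<noteq> {}" using lower_cost_in_uncertainty_set by blast
  ultimately have "(MAX c\<in>uncertainty_set I. MIN y\<in>second_stage I x. \<Sum>i\<in>items I. c i * y i)
        \<le> v - (\<Sum>i\<in>items I. first_cost I i * x i) \<longleftrightarrow>
      (\<forall>c\<in>uncertainty_set I. \<exists>y\<in>second_stage I x.
        (\<Sum>i\<in>items I. c i * y i) \<le> v - (\<Sum>i\<in>items I. first_cost I i * x i))"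
    using finite_uncertainty_set[of I] by (subst Max_le_iff) auto
  then show ?thesis by (simp add: r2st_cost_def algebra_simps)
qed

section \<open>Correctness of the formulation\<close>

text \<open>The amount by which \<open>selection_dual\<close> at \<open>t\<close> grows when the
  cost of item \<open>i\<close> is raised; also the right-hand side of the \<open>Dual\<close>
  constraints.\<close>

definition dual_gain :: "r2st \<Rightarrow> (nat \<Rightarrow> real) \<Rightarrow> real \<Rightarrow> nat \<Rightarrow> real" where
  "dual_gain I x t i =
     (1 - x i) * (pos_part (t - lower_cost I i) - pos_part (t - lower_cost I i - dev I i))"

text \<open>At fixed \<open>t\<close> the dual function separates over items, so the gains of raised
  items add up. The adversary thus faces the budget problem with weights
  \<open>dual_gain I x t\<close>.\<close>

lemma selection_dual_raised:
  assumes "S \<subseteq> items I" "\<And>i. i \<in> items I \<Longrightarrow> c i = lower_cost I i + (if i \<in> S then dev I i else 0)"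
  shows "selection_dual I x c t = selection_dual I x (lower_cost I) t + sum (dual_gain I x t) S"
proof -
  have "sum (dual_gain I x t) S = (\<Sum>i\<in>items I. if i \<in> S then dual_gain I x t i else 0)"
    using assms(1) by (simp add: sum.inter_restrict[symmetric] Int_absorb1)
  moreover have "(\<Sum>i\<in>items I. (1 - x i) * pos_part (t - c i)) =
      (\<Sum>i\<in>items I. (1 - x i) * pos_part (t - lower_cost I i) - (if i \<in> S then dual_gain I x t i else 0))"
    using assms(2) by (intro sum.cong) (auto simp: dual_gain_def algebra_simps)
  ultimately show ?thesis by (simp add: selection_dual_def sum_subtractf)
qed

lemma Rho_set_eq: "{Rho i l | i l. i \<in> A \<and> l \<in> B} = (\<lambda>(i, l). Rho i l) ` (A \<times> B)"
  by auto

lemma Dual_set_eq: "{Dual i l | i l. i \<in> A \<and> l \<in> B} = (\<lambda>(i, l). Dual i l) ` (A \<times> B)"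
  by auto

text \<open>Recasts the constraints in the vocabulary of the dualities: each
  \<open>Lam_bound\<close> is first-stage cost plus \<open>selection_dual\<close> plus the budget
  dual objective.\<close>

lemma feasible_r2st_milp_iff:
  "feasible (r2st_milp I a) z \<longleftrightarrow>
    (\<forall>l\<in>levels I. (\<Sum>i\<in>items I. first_cost I i * x_part I z i)
        + selection_dual I (x_part I z) (lower_cost I) (a l)
        + (real (Gam I) * z (Pi_var l) + (\<Sum>i\<in>items I. z (Rho i l))) \<le> z Lam) \<and>
    x_part I z \<in> first_stage I \<and>
    (\<forall>l\<in>levels I. 0 \<le> z (Pi_var l) \<and>
      (\<forall>i\<in>items I. 0 \<le> z (Rho i l) \<and> dual_gain I (x_part I z) (a l) i \<le> z (Pi_var l) + z (Rho i l)))"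
proof -
  have "x_part I z i = z (X i)" if "i \<in> items I" for i
    using that by (simp add: x_part_def)
  note [simp] = this
  have "x_part I z \<in> first_stage I \<longleftrightarrow>
      (\<forall>i\<in>items I. z (X i) \<in> {0, 1}) \<and> (\<Sum>i\<in>items I. z (X i)) \<le> real (sel I)"
    by (auto simp: first_stage_def x_part_def PiE_def Pi_def extensional_def)
  then show ?thesis
    unfolding feasible_def r2st_milp_def pi_rho_vars_def selection_dual_def dual_gain_def
      Rho_set_eq Dual_set_eq
    by (simp add: ball_Un split_beta add.assoc del: One_nat_def) (auto simp: add.assoc)
qed

text \<open>For each scenario, second-stage strong duality supplies a response and a level
  \<open>t\<close>; budget weak duality at that level bounds the scenario's gain by
  \<open>\<pi>\<close> and \<open>\<rho>\<close>, hence the total by \<open>z Lam\<close>.\<close>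

lemma r2st_cost_le_objective:
  assumes I: "valid_instance I" and a: "a ` levels I = breakpoints I"
    and z: "feasible (r2st_milp I a) z"
  shows "r2st_cost I (x_part I z) \<le> z Lam"
proof -
  define x where "x = x_part I z"
  have x: "x \<in> first_stage I" using z by (simp add: feasible_r2st_milp_iff x_def)
  have "\<exists>y\<in>second_stage I x. (\<Sum>i\<in>items I. first_cost I i * x i) + (\<Sum>i\<in>items I. c i * y i) \<le> z Lam"
    if "c \<in> uncertainty_set I" for c
  proof -
    obtain \<delta> where \<delta>: "c = (\<lambda>i\<in>items I. lower_cost I i + \<delta> i)"
      "\<forall>i\<in>items I. \<delta> i \<in> {0, dev I i}" "card {i \<in> items I. \<delta> i \<noteq> 0} \<le> Gam I"
      using \<open>c \<in> uncertainty_set I\<close> by (auto simp: uncertainty_set_def)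
    define S where "S = {i \<in> items I. \<delta> i \<noteq> 0}"
    have S: "S \<subseteq> items I" "card S \<le> Gam I" using \<delta>(3) by (auto simp: S_def)
    have c: "c i = lower_cost I i + (if i \<in> S then dev I i else 0)" if "i \<in> items I" for i
      using that \<delta>(1,2) by (auto simp: S_def)
    have c_mem: "c i \<in> {lower_cost I i, upper_cost I i}" if "i \<in> items I" for i
      using c[OF that] by (simp add: dev_def)
    then have "0 \<le> c i" if "i \<in> items I" for i
      using that I by (fastforce simp: valid_instance_def)
    then obtain y t where y: "y \<in> second_stage I x" and t: "t \<in> insert 0 (c ` items I)"
      and eq: "(\<Sum>i\<in>items I. c i * y i) = selection_dual I x c t"
      using second_stage_strong_duality[OF I x, of c] by blast
    \<comment> \<open>Every scenario cost is a lower or an upper cost, so the threshold is always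
      one of the enumerated levels.\<close>
    have "t \<in> breakpoints I" using t c_mem unfolding breakpoints_def by blast
    then obtain l where l: "l \<in> levels I" "t = a l" using a by blast
    have "sum (dual_gain I x t) S \<le> real (Gam I) * z (Pi_var l) + (\<Sum>i\<in>items I. z (Rho i l))"
      using z l S by (intro budget_weak_duality) (auto simp: feasible_r2st_milp_iff x_def)
    moreover have "(\<Sum>i\<in>items I. first_cost I i * x i) + selection_dual I x (lower_cost I) t
        + (real (Gam I) * z (Pi_var l) + (\<Sum>i\<in>items I. z (Rho i l))) \<le> z Lam"
      using z l by (simp add: feasible_r2st_milp_iff x_def)
    ultimately show ?thesis
      using y eq selection_dual_raised[of S I c x t, OF S(1) c] by (intro bexI[of _ y]) simp_all
  qed
  then show ?thesis using r2st_cost_le_iff[OF I x] by (simp add: x_def)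
qed

text \<open>The dualities swap roles: at each level, budget strong duality gives
  \<open>\<pi>\<close> and \<open>\<rho>\<close> worth the gain of some set \<open>S l\<close>, and
  second-stage weak duality in the scenario raising \<open>S l\<close> bounds the constraint by the
  true cost.\<close>

lemma r2st_cost_attained:
  assumes I: "valid_instance I" and x: "x \<in> first_stage I"
  shows "\<exists>z. feasible (r2st_milp I a) z \<and> x_part I z = x \<and> z Lam = r2st_cost I x"
proof -
  have x01: "x i \<in> {0, 1}" if "i \<in> items I" for i
    using x that by (auto simp: first_stage_def PiE_def Pi_def)
  have "0 \<le> dual_gain I x (a l) i" if "i \<in> items I" for i l
  proof -
    have "lower_cost I i \<le> upper_cost I i" using I that by (auto simp: valid_instance_def)
    then show ?thesis using x01[OF that] by (auto simp: dual_gain_def pos_part_def dev_def)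
  qed
  then have "\<forall>l. \<exists>S \<pi> \<rho>. S \<subseteq> items I \<and> card S \<le> Gam I \<and> 0 \<le> \<pi> \<and>
      (\<forall>i\<in>items I. 0 \<le> \<rho> i \<and> dual_gain I x (a l) i \<le> \<pi> + \<rho> i) \<and>
      real (Gam I) * \<pi> + sum \<rho> (items I) = sum (dual_gain I x (a l)) S"
    by (intro allI budget_strong_duality) auto
  then obtain S \<pi> \<rho> where S: "\<And>l. S l \<subseteq> items I" "\<And>l. card (S l) \<le> Gam I"
    and \<pi>: "\<And>l. 0 \<le> \<pi> l"
    and \<rho>: "\<And>l i. i \<in> items I \<Longrightarrow> 0 \<le> \<rho> l i \<and> dual_gain I x (a l) i \<le> \<pi> l + \<rho> l i"
    and eq: "\<And>l. real (Gam I) * \<pi> l + sum (\<rho> l) (items I) = sum (dual_gain I x (a l)) (S l)"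
    by metis
  define z where "z v = (case v of Lam \<Rightarrow> r2st_cost I x | X i \<Rightarrow> x i | Pi_var l \<Rightarrow> \<pi> l | Rho i l \<Rightarrow> \<rho> l i)" for v
  have xz: "x_part I z = x"
    using x by (auto simp: x_part_def z_def first_stage_def PiE_def extensional_def)
  have "(\<Sum>i\<in>items I. first_cost I i * x i) + selection_dual I x (lower_cost I) (a l)
      + sum (dual_gain I x (a l)) (S l) \<le> r2st_cost I x" for l
  proof -
    define c where "c = (\<lambda>i\<in>items I. lower_cost I i + (if i \<in> S l then dev I i else 0))"
    \<comment> \<open>Only an inequality: items of \<open>S l\<close> with zero deviation do not
      count against the budget.\<close>
    have "card {i \<in> items I. (if i \<in> S l then dev I i else 0) \<noteq> 0} \<le> card (S l)"
      using finite_subset[OF S(1)[of l]] by (intro card_mono) auto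
    then have "c \<in> uncertainty_set I"
      unfolding uncertainty_set_def c_def using S(2)[of l]
      by (intro CollectI exI[of _ "\<lambda>i. if i \<in> S l then dev I i else 0"]) auto
    \<comment> \<open>The characterisation at \<open>v = r2st_cost I x\<close>, where its left side
      is trivially true, yields a response within that cost.\<close>
    then obtain y where y: "y \<in> second_stage I x"
      "(\<Sum>i\<in>items I. first_cost I i * x i) + (\<Sum>i\<in>items I. c i * y i) \<le> r2st_cost I x"
      using r2st_cost_le_iff[OF I x, of "r2st_cost I x"] by auto
    have "selection_dual I x c (a l) \<le> (\<Sum>i\<in>items I. c i * y i)"
      using x01 y(1) by (rule second_stage_weak_duality)
    moreover have "selection_dual I x c (a l)
        = selection_dual I x (lower_cost I) (a l) + sum (dual_gain I x (a l)) (S l)"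
      using S(1) by (rule selection_dual_raised) (simp add: c_def)
    ultimately show ?thesis using y(2) by linarith
  qed
  then have "feasible (r2st_milp I a) z"
    using \<pi> \<rho> x eq by (simp add: feasible_r2st_milp_iff xz) (simp add: z_def)
  then show ?thesis using xz by (auto simp: z_def)
qed

text \<open>Every feasible point costs at least its \<open>x_part\<close>, and every first-stage
  choice lifts to a feasible point of equal cost, so the minima agree.\<close>

lemma r2st_milp_correct:
  assumes I: "valid_instance I" and a: "a ` levels I = breakpoints I"
  shows "has_optimal_value (r2st_milp I a) (r2st_value I)"
    and "optimal (r2st_milp I a) z \<Longrightarrow> r2st_optimal I (x_part I z)"
proof -
  have obj: "objective (r2st_milp I a) z = z Lam" for z by (simp add: r2st_milp_def)
  have value_le: "r2st_value I \<le> r2st_cost I x" if "x \<in> first_stage I" for x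
    unfolding r2st_value_def using that finite_first_stage by (intro Min_le) auto
  have "r2st_value I \<in> r2st_cost I ` first_stage I"
    unfolding r2st_value_def using finite_first_stage zero_in_first_stage by (intro Min_in) auto
  then obtain x where x: "x \<in> first_stage I" "r2st_value I = r2st_cost I x" by auto
  then obtain z\<^sub>0 where z\<^sub>0: "feasible (r2st_milp I a) z\<^sub>0" "z\<^sub>0 Lam = r2st_value I"
    using r2st_cost_attained[OF I x(1)] by metis
  have bounds: "x_part I z \<in> first_stage I" "r2st_cost I (x_part I z) \<le> z Lam"
    if "feasible (r2st_milp I a) z" for z
    using that r2st_cost_le_objective[OF I a that] by (auto simp: feasible_r2st_milp_iff)
  have "r2st_value I \<le> z Lam" if "feasible (r2st_milp I a) z" for z
    using bounds[OF that] value_le by force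
  then show "has_optimal_value (r2st_milp I a) (r2st_value I)"
    using z\<^sub>0 by (auto simp: has_optimal_value_def optimal_def obj)
  show "r2st_optimal I (x_part I z)" if "optimal (r2st_milp I a) z"
  proof -
    \<comment> \<open>Comparison with the lifted optimum \<open>z\<^sub>0\<close> squeezes the cost
      of \<open>x_part I z\<close> between \<open>r2st_value I\<close> and itself.\<close>
    have "feasible (r2st_milp I a) z" "z Lam \<le> r2st_value I"
      using that z\<^sub>0 by (force simp: optimal_def obj)+
    then show ?thesis
      using bounds[of z] value_le[of "x_part I z"] by (simp add: r2st_optimal_def)
  qed
qed

section \<open>Linearity and size\<close>

lemma affine_in_const: "affine_in V (\<lambda>z. b)"
  unfolding affine_in_def by (intro exI[of _ "\<lambda>_. 0"] exI[of _ b]) simp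

lemma affine_in_var:
  assumes "finite V" "v \<in> V"
  shows "affine_in V (\<lambda>z. z v)"
  unfolding affine_in_def
  using assms by (intro exI[of _ "\<lambda>u. of_bool (u = v)"] exI[of _ 0]) simp

lemma affine_in_add:
  assumes "affine_in V f" "affine_in V g"
  shows "affine_in V (\<lambda>z. f z + g z)"
proof -
  obtain a b a' b' where "\<forall>z. f z = (\<Sum>v\<in>V. a v * z v) + b" "\<forall>z. g z = (\<Sum>v\<in>V. a' v * z v) + b'"
    using assms unfolding affine_in_def by blast
  then show ?thesis unfolding affine_in_def
    by (intro exI[of _ "\<lambda>v. a v + a' v"] exI[of _ "b + b'"]) (simp add: sum.distrib algebra_simps)
qed

lemma affine_in_cmult:
  assumes "affine_in V f"
  shows "affine_in V (\<lambda>z. k * f z)"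
proof -
  obtain a b where "\<forall>z. f z = (\<Sum>v\<in>V. a v * z v) + b"
    using assms unfolding affine_in_def by blast
  then show ?thesis unfolding affine_in_def
    by (intro exI[of _ "\<lambda>v. k * a v"] exI[of _ "k * b"]) (simp add: sum_distrib_left algebra_simps)
qed

lemma affine_in_multc: "affine_in V f \<Longrightarrow> affine_in V (\<lambda>z. f z * k)"
  using affine_in_cmult[of V f k] by (simp add: mult.commute)

lemma affine_in_diff: "affine_in V f \<Longrightarrow> affine_in V g \<Longrightarrow> affine_in V (\<lambda>z. f z - g z)"
  using affine_in_add[of V f "\<lambda>z. - 1 * g z"] affine_in_cmult[of V g "- 1"] by simp

lemma affine_in_sum:
  "(\<And>i. i \<in> A \<Longrightarrow> affine_in V (f i)) \<Longrightarrow> affine_in V (\<lambda>z. \<Sum>i\<in>A. f i z)"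
  by (induction A rule: infinite_finite_induct) (auto intro: affine_in_const affine_in_add)

text \<open>Breakpoints, costs and positive parts are data, so every product has a constant factor
  and the closure rules for affine functions apply.\<close>

lemma is_milp_r2st_milp: "is_milp (r2st_milp I a)"
proof -
  let ?V = "vars (r2st_milp I a)"
  have fin: "finite ?V"
    unfolding r2st_milp_def pi_rho_vars_def Rho_set_eq by simp
  have mem: "Lam \<in> ?V" "\<And>i. i \<in> items I \<Longrightarrow> X i \<in> ?V" "\<And>l. l \<in> levels I \<Longrightarrow> Pi_var l \<in> ?V"
    "\<And>i l. i \<in> items I \<Longrightarrow> l \<in> levels I \<Longrightarrow> Rho i l \<in> ?V"
    by (auto simp: r2st_milp_def pi_rho_vars_def)
  note intros = affine_in_const affine_in_add affine_in_diff affine_in_cmult affine_in_multc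
    affine_in_sum affine_in_var[OF fin] mem
  have "affine_in ?V (r2st_lhs I a k) \<and> affine_in ?V (r2st_rhs I a k)"
    if k: "k \<in> ineqs (r2st_milp I a)" for k
  proof -
    \<comment> \<open>The range of the indices matters: it places the variables that occur inside
      \<open>?V\<close>.\<close>
    consider l where "k = Lam_bound l" "l \<in> levels I" | "k = Cardinality"
      | i l where "k = Dual i l" "i \<in> items I" "l \<in> levels I"
      using k unfolding r2st_milp_def milp.simps by blast
    then show ?thesis
    proof cases
      case (1 l)
      then show ?thesis
        unfolding 1(1) r2st_lhs.simps r2st_rhs.simps using 1(2) by (auto intro!: intros)
    next
      case 2
      then show ?thesis
        unfolding 2 r2st_lhs.simps r2st_rhs.simps by (auto intro!: intros)
    next
      case (3 i l)
      then show ?thesis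
        unfolding 3(1) r2st_lhs.simps r2st_rhs.simps using 3(2,3) by (auto intro!: intros)
    qed
  qed
  moreover have "affine_in ?V (objective (r2st_milp I a))"
    using affine_in_var[OF fin mem(1)] by (simp add: r2st_milp_def)
  moreover have "binaries (r2st_milp I a) \<subseteq> ?V" "nonnegs (r2st_milp I a) \<subseteq> ?V"
    by (auto simp: r2st_milp_def)
  moreover have "finite (ineqs (r2st_milp I a))"
    unfolding r2st_milp_def Dual_set_eq by simp
  moreover have "lhs (r2st_milp I a) = r2st_lhs I a" "rhs (r2st_milp I a) = r2st_rhs I a"
    by (simp_all add: r2st_milp_def)
  ultimately show ?thesis using fin by (simp add: is_milp_def)
qed

section \<open>Counting variables and constraints\<close>

lemma num_breakpoints_le: "num_breakpoints I \<le> 2 * num_items I + 1"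
proof -
  have "num_breakpoints I
      \<le> card {0 :: real} + card (lower_cost I ` items I) + card (upper_cost I ` items I)"
    unfolding breakpoints_def by (meson add_le_mono1 card_Un_le order_trans)
  also have "\<dots> \<le> 1 + num_items I + num_items I"
    using card_image_le[of "items I" "lower_cost I"] card_image_le[of "items I" "upper_cost I"]
    by simp
  finally show ?thesis by simp
qed

lemma card_pi_rho_vars_le: "card (pi_rho_vars I) \<le> num_breakpoints I + num_items I * num_breakpoints I"
proof -
  have "card (pi_rho_vars I) \<le> card (Pi_var ` levels I) + card ((\<lambda>(i, l). Rho i l) ` (items I \<times> levels I))"
    unfolding pi_rho_vars_def Rho_set_eq by (rule card_Un_le)
  also have "\<dots> \<le> card (levels I) + card (items I \<times> levels I)"
    by (intro add_mono card_image_le) auto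
  finally show ?thesis by (simp add: card_cartesian_product)
qed

lemma num_vars_le:
  "num_vars (r2st_milp I a) \<le> 1 + num_items I + (num_items I + 1) * num_breakpoints I"
proof -
  have "num_vars (r2st_milp I a) \<le> card {Lam} + card (X ` items I) + card (pi_rho_vars I)"
    unfolding num_vars_def r2st_milp_def milp.simps by (meson add_le_mono1 card_Un_le order_trans)
  then show ?thesis
    using card_pi_rho_vars_le[of I] card_image_le[of "items I" X] by simp
qed

text \<open>The factor 2 arises because the level-indexed inequalities and the sign restrictions on
  \<open>Pi_var\<close> and \<open>Rho\<close> each contribute
  \<open>(num_items I + 1) * num_breakpoints I\<close>.\<close>

lemma num_constraints_le:
  "num_constraints (r2st_milp I a) \<le> 1 + num_items I + 2 * (num_items I + 1) * num_breakpoints I"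
proof -
  have "card (ineqs (r2st_milp I a)) \<le> card (Lam_bound ` levels I) + card {Cardinality}
      + card ((\<lambda>(i, l). Dual i l) ` (items I \<times> levels I))"
    unfolding r2st_milp_def Dual_set_eq milp.simps by (meson add_le_mono1 card_Un_le order_trans)
  also have "\<dots> \<le> card (levels I) + 1 + card (items I \<times> levels I)"
    by (intro add_mono card_image_le) auto
  finally have "card (ineqs (r2st_milp I a)) \<le> num_breakpoints I + 1 + num_items I * num_breakpoints I"
    by (simp add: card_cartesian_product)
  moreover have "card (binaries (r2st_milp I a)) \<le> num_items I"
    using card_image_le[of "items I" X] by (simp add: r2st_milp_def)
  moreover have "card (nonnegs (r2st_milp I a)) \<le> num_breakpoints I + num_items I * num_breakpoints I"
    using card_pi_rho_vars_le[of I] by (simp add: r2st_milp_def)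
  ultimately show ?thesis by (simp add: num_constraints_def)
qed

lemma bigo_large_instances:
  assumes "\<And>I. f I \<le> 1 + num_items I + 2 * (num_items I + 1) * num_breakpoints I"
  shows "(\<lambda>I. real (f I)) \<in> O[large_instances](\<lambda>I. real (num_items I) ^ 2)"
proof (rule bigoI)
  \<comment> \<open>At most \<open>2 * n + 1\<close> breakpoints give
    \<open>4 * n ^ 2 + 7 * n + 3\<close>; since \<open>n \<ge> 1\<close>, the constant is 4 + 7 + 3
    = 14.\<close>
  have "f I \<le> 14 * num_items I ^ 2" if "valid_instance I" for I
  proof -
    define n where "n = num_items I"
    have n: "1 \<le> n" using that by (auto simp: valid_instance_def n_def)
    have "f I \<le> 1 + n + 2 * (n + 1) * (2 * n + 1)"
      unfolding n_def
      by (rule order_trans[OF assms add_left_mono[OF mult_left_mono[OF num_breakpoints_le]]]) simp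
    also have "\<dots> = 4 * n ^ 2 + 7 * n + 3" by (simp add: power2_eq_square algebra_simps)
    also have "\<dots> \<le> 14 * n ^ 2"
      using n self_le_power[of n 2] one_le_power[of n 2] by linarith
    finally show ?thesis by (simp add: n_def)
  qed
  then have "norm (real (f I)) \<le> 14 * norm (real (num_items I) ^ 2)" if "valid_instance I" for I
    using that by (simp flip: of_nat_power) (metis of_nat_le_iff of_nat_mult of_nat_numeral)
  \<comment> \<open>The bound holds at every valid instance, so the principal part of the filter
    already gives it.\<close>
  then show "eventually (\<lambda>I. norm (real (f I)) \<le> 14 * norm (real (num_items I) ^ 2)) large_instances"
    unfolding large_instances_def eventually_inf_principal by (intro always_eventually) auto
qed

theorem mainTheorem9:
  fixes \<alpha> :: "r2st \<Rightarrow> nat \<Rightarrow> real"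
  assumes enum: "\<And>I. valid_instance I \<Longrightarrow>
    bij_betw (\<alpha> I) {1..num_breakpoints I} (breakpoints I)"
  shows "(\<forall>I. valid_instance I \<longrightarrow>
            is_milp (r2st_milp I (\<alpha> I)) \<and>
            has_optimal_value (r2st_milp I (\<alpha> I)) (r2st_value I) \<and>
            (\<forall>z. optimal (r2st_milp I (\<alpha> I)) z \<longrightarrow> r2st_optimal I (x_part I z))) \<and>
         (\<lambda>I. real (num_vars (r2st_milp I (\<alpha> I))))
            \<in> O[large_instances](\<lambda>I. real (num_items I) ^ 2) \<and>
         (\<lambda>I. real (num_constraints (r2st_milp I (\<alpha> I))))
            \<in> O[large_instances](\<lambda>I. real (num_items I) ^ 2)"
proof (intro conjI allI impI)
  fix I assume I: "valid_instance I"
  have a: "\<alpha> I ` levels I = breakpoints I"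
    using enum[OF I] by (rule bij_betw_imp_surj_on)
  show "is_milp (r2st_milp I (\<alpha> I))" by (rule is_milp_r2st_milp)
  show "has_optimal_value (r2st_milp I (\<alpha> I)) (r2st_value I)"
    using I a by (rule r2st_milp_correct)
  show "r2st_optimal I (x_part I z)" if "optimal (r2st_milp I (\<alpha> I)) z" for z
    using I a that by (rule r2st_milp_correct)
next
  show "(\<lambda>I. real (num_vars (r2st_milp I (\<alpha> I))))
      \<in> O[large_instances](\<lambda>I. real (num_items I) ^ 2)"
  proof (rule bigo_large_instances)
    \<comment> \<open>The variable count is weakened to the bound shared with the constraint
      count.\<close>
    show "num_vars (r2st_milp I (\<alpha> I)) \<le> 1 + num_items I + 2 * (num_items I + 1) * num_breakpoints I" for I
      using num_vars_le[of I "\<alpha> I"] by (simp add: algebra_simps)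
  qed
  show "(\<lambda>I. real (num_constraints (r2st_milp I (\<alpha> I))))
      \<in> O[large_instances](\<lambda>I. real (num_items I) ^ 2)"
    using num_constraints_le by (rule bigo_large_instances)
qed

end
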